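(* Let $(R,+,\cdot)$ be a commutative ring with a multiplicative unit element $e$ and let $A:R\to\mathbb{R}$ be an additive function with $A(e)\neq 0$. Let the subset $R_A\subseteq R$ be defined by $$R_A:=\{x\in R\mid 0\leq A(x^2)A(e)\}.$$ Then $e\in R_A$, and the following two conditions are equivalent: (a) $A(x^2)\,A(y^2)\leq A(xy)^2$ for all $x,y\in R_A$; (b) $A(x^2)\,A(e)\leq A(x)^2$ for all $x\in R_A$.
   Context: A function $A:R\to\mathbb{R}$ is additive if $A(x+y)=A(x)+A(y)$ for all $x,y\in R$. The product $x\cdot y$ is written $xy$, $x^2:=x\cdot x$, and $A(u)^2$ denotes $(A(u))^2$. *)

theory Defs imports Complex_Main begin

definition nonneg_square_set :: "('a::comm_ring_1 \<Rightarrow> real) \<Rightarrow> 'a set" where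
  "nonneg_square_set A = {x. 0 \<le> A (x\<^sup>2) * A 1}"

end

theory Submission imports Defs begin

text \<open>
  Taking \<open>y = 1\<close> in (a) gives (b), so only the converse has content.

  Put \<open>Q(x) = A(x)\<^sup>2 - A(x\<^sup>2) A(1)\<close>. Condition (b) says that \<open>Q\<close> is nonnegative on the set
  \<open>nonneg_square_set A\<close>, and off this set \<open>Q\<close> is nonnegative automatically because there
  \<open>A(x\<^sup>2) A(1) < 0\<close>. So \<open>Q\<close> is a positive semidefinite quadratic form on the additive group of
  the ring, with polar form \<open>A(x) A(y) - A(xy) A(1)\<close>. The Cauchy--Schwarz inequality for \<open>Q\<close>
  holds although only integer combinations of \<open>x\<close> and \<open>y\<close> are available: rational directions
  are dense enough to detect a negative value of a real binary form
  (\<open>binary_form_cauchy_schwarz\<close>).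

  What is then left is the passage from Cauchy--Schwarz for \<open>Q\<close> to the reversed inequality for
  \<open>A(x\<^sup>2)\<close>, as for causal vectors in Minkowski space, where \<open>A(x)\<close> is the time coordinate
  and \<open>Q\<close> the squared spatial length. It is a statement about five real numbers
  (\<open>reversed_cauchy_schwarz\<close>).
\<close>

text \<open>
  For a positive leading coefficient \<open>p\<close>, completing the square turns the form into
  \<open>p (n + m b/p)\<^sup>2 + m\<^sup>2 (q - b\<^sup>2/p)\<close>. Rounding \<open>- m b/p\<close> to the nearest integer bounds
  \<open>(n + m b/p)\<^sup>2\<close> by \<open>1/4\<close> for every \<open>m\<close>, whereas a negative second term would
  be unbounded in \<open>m\<close>. For \<open>p = 0\<close> and \<open>m = 1\<close> the form is affine in \<open>n\<close>, hence constant.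
\<close>

lemma binary_form_cauchy_schwarz:
  fixes p b q :: real
  assumes nonneg: "\<And>n m :: int. 0 \<le> (of_int n)\<^sup>2 * p + 2 * of_int n * of_int m * b + (of_int m)\<^sup>2 * q"
  shows "b\<^sup>2 \<le> p * q"
proof -
  have "0 \<le> p" using nonneg[of 1 0] by simp
  then consider "p = 0" | "0 < p" by linarith
  then show ?thesis
  proof cases
    case 1
    have linear: "0 \<le> 2 * of_int n * b + q" for n
      using nonneg[of n 1] 1 by simp
    have "b = 0"
    proof (rule ccontr)
      assume "b \<noteq> 0"
      then obtain k :: nat where k: "q < real k * \<bar>b\<bar>"
        using reals_Archimedean3[of "\<bar>b\<bar>"] by auto
      have "0 \<le> q" using linear[of 0] by simp
      moreover have "0 \<le> - 2 * (real k * \<bar>b\<bar>) + q"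
        using linear[of "int k"] linear[of "- int k"] by (cases "0 \<le> b") auto
      ultimately show False using k by linarith
    qed
    then show ?thesis using 1 by simp
  next
    case 2
    define d where "d = b\<^sup>2 / p - q"
    have growth: "real k * d \<le> p / 4" if "0 < k" for k :: nat
    proof -
      define n where "n = round (- real k * b / p)"
      have "\<bar>of_int n - (- real k * b / p)\<bar> \<le> 1 / 2"
        unfolding n_def by (rule of_int_round_abs_le)
      then have "(of_int n + real k * b / p)\<^sup>2 \<le> (1 / 2)\<^sup>2"
        by (intro abs_le_square_iff[THEN iffD1]) linarith
      then have "p * (of_int n + real k * b / p)\<^sup>2 \<le> p * (1 / 4)"
        using 2 by (intro mult_left_mono) (auto simp: power2_eq_square)
      moreover have "(of_int n)\<^sup>2 * p + 2 * of_int n * of_int (int k) * b + (of_int (int k))\<^sup>2 * q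
          = p * (of_int n + real k * b / p)\<^sup>2 - (real k)\<^sup>2 * d"
        using 2 unfolding d_def by (simp add: field_simps power2_eq_square)
      ultimately have square: "(real k)\<^sup>2 * d \<le> p / 4"
        using nonneg[of n "int k"] by linarith
      show ?thesis
      proof (cases "0 \<le> d")
        case True
        have "real k \<le> (real k)\<^sup>2" using that by (simp add: power2_eq_square)
        then have "real k * d \<le> (real k)\<^sup>2 * d" using True by (rule mult_right_mono)
        then show ?thesis using square by linarith
      next
        case False
        then have "real k * d \<le> 0" by (simp add: mult_nonneg_nonpos)
        then show ?thesis using 2 by linarith
      qed
    qed
    have "d \<le> 0"
    proof (rule ccontr)
      assume "\<not> d \<le> 0"
      then obtain k :: nat where k: "p / 4 < real k * d"
        using reals_Archimedean3[of d] unfolding not_le by blast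
      then have "0 < k" using 2 by (cases k) auto
      then show False using growth[of k] k by linarith
    qed
    then show ?thesis using 2 unfolding d_def by (simp add: field_simps)
  qed
qed

text \<open>
  With \<open>p = a\<^sup>2 - u\<close> and \<open>q = b\<^sup>2 - v\<close>, where \<open>u, v\<close> are squared spatial lengths, the
  Cauchy--Schwarz inequality in the plane for the vectors \<open>(\<surd>p, \<surd>u)\<close> and \<open>(\<surd>q, \<surd>v)\<close>, of
  lengths \<open>\<bar>a\<bar>\<close> and \<open>\<bar>b\<bar>\<close>, gives \<open>\<surd>(p q) + \<surd>(u v) \<le> \<bar>a b\<bar>\<close>. Since \<open>c\<close> is within \<open>\<surd>(u v)\<close> of
  \<open>a b\<close>, it follows that \<open>\<bar>c\<bar> \<ge> \<surd>(p q)\<close>.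
\<close>

lemma reversed_cauchy_schwarz:
  fixes a b c p q :: real
  assumes p: "0 \<le> p" "p \<le> a\<^sup>2" and q: "0 \<le> q" "q \<le> b\<^sup>2"
    and cs: "(a * b - c)\<^sup>2 \<le> (a\<^sup>2 - p) * (b\<^sup>2 - q)"
  shows "p * q \<le> c\<^sup>2"
proof -
  define s where "s = sqrt (p * q)"
  define r where "r = sqrt ((a\<^sup>2 - p) * (b\<^sup>2 - q))"
  have s: "0 \<le> s" "s\<^sup>2 = p * q" using p q unfolding s_def by auto
  have r: "0 \<le> r" "r\<^sup>2 = (a\<^sup>2 - p) * (b\<^sup>2 - q)" using p q unfolding r_def by auto
  have "s * r = sqrt ((p * (b\<^sup>2 - q)) * (q * (a\<^sup>2 - p)))"
    unfolding s_def r_def by (simp add: real_sqrt_mult[symmetric] mult_ac)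
  also have "\<dots> \<le> (p * (b\<^sup>2 - q) + q * (a\<^sup>2 - p)) / 2"
    using p q by (intro arith_geo_mean_sqrt) auto
  finally have "(s + r)\<^sup>2 \<le> (a * b)\<^sup>2"
    unfolding power2_sum s(2) r(2) by (simp add: algebra_simps power_mult_distrib)
  then have "\<bar>s + r\<bar> \<le> \<bar>a * b\<bar>" by (simp only: abs_le_square_iff)
  moreover have "\<bar>a * b - c\<bar> \<le> \<bar>r\<bar>"
    using cs by (simp only: abs_le_square_iff r(2))
  ultimately have "\<bar>s\<bar> \<le> \<bar>c\<bar>" using s(1) r(1) by linarith
  then show ?thesis by (simp only: abs_le_square_iff s(2))
qed

lemma additive_of_int_mult:
  fixes A :: "'a::ring_1 \<Rightarrow> real"
  assumes "additive A"
  shows "A (of_int n * x) = of_int n * A x"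
proof -
  interpret additive A by fact
  show ?thesis
  proof (induction n rule: int_induct[of _ 0])
    case base
    show ?case by (simp add: zero)
  next
    case (step1 i)
    then show ?case by (simp only: of_int_add of_int_1 distrib_right mult_1_left add)
  next
    case (step2 i)
    then show ?case by (simp only: of_int_diff of_int_1 left_diff_distrib mult_1_left diff)
  qed
qed

text \<open>
  With \<open>Q(z) = A(z)\<^sup>2 - A(z\<^sup>2) A(1)\<close>, the value of \<open>Q\<close> at \<open>n x + m y\<close> is the binary form in \<open>n, m\<close> with coefficients \<open>Q(x)\<close>,
  \<open>A(x) A(y) - A(xy) A(1)\<close> and \<open>Q(y)\<close>.
\<close>

lemma additive_cauchy_schwarz:
  fixes A :: "'a::comm_ring_1 \<Rightarrow> real"
  assumes "additive A" and Q_nonneg: "\<And>z. A (z\<^sup>2) * A 1 \<le> (A z)\<^sup>2"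
  shows "(A x * A y - A (x * y) * A 1)\<^sup>2
    \<le> ((A x)\<^sup>2 - A (x\<^sup>2) * A 1) * ((A y)\<^sup>2 - A (y\<^sup>2) * A 1)"
proof (rule binary_form_cauchy_schwarz)
  fix n m :: int
  interpret additive A by fact
  note scale = additive_of_int_mult[OF \<open>additive A\<close>]
  define z where "z = of_int n * x + of_int m * y"
  have "z\<^sup>2 = of_int (n\<^sup>2) * x\<^sup>2 + of_int (2 * n * m) * (x * y) + of_int (m\<^sup>2) * y\<^sup>2"
    unfolding z_def by (simp add: power2_eq_square algebra_simps)
  then have "A (z\<^sup>2) = of_int (n\<^sup>2) * A (x\<^sup>2) + of_int (2 * n * m) * A (x * y) + of_int (m\<^sup>2) * A (y\<^sup>2)"
    by (simp only: add scale)
  moreover have "A z = of_int n * A x + of_int m * A y"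
    unfolding z_def by (simp only: add scale)
  ultimately have "(A z)\<^sup>2 - A (z\<^sup>2) * A 1
      = (of_int n)\<^sup>2 * ((A x)\<^sup>2 - A (x\<^sup>2) * A 1)
        + 2 * of_int n * of_int m * (A x * A y - A (x * y) * A 1)
        + (of_int m)\<^sup>2 * ((A y)\<^sup>2 - A (y\<^sup>2) * A 1)"
    by (simp add: power2_eq_square algebra_simps)
  then show "0 \<le> (of_int n)\<^sup>2 * ((A x)\<^sup>2 - A (x\<^sup>2) * A 1)
        + 2 * of_int n * of_int m * (A x * A y - A (x * y) * A 1)
        + (of_int m)\<^sup>2 * ((A y)\<^sup>2 - A (y\<^sup>2) * A 1)"
    using Q_nonneg[of z] by linarith
qed

theorem theorem3p4:
  fixes A :: "'a::comm_ring_1 \<Rightarrow> real"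
  assumes "additive A" and "A 1 \<noteq> 0"
  shows "1 \<in> nonneg_square_set A \<and>
    ((\<forall>x\<in>nonneg_square_set A. \<forall>y\<in>nonneg_square_set A. A (x\<^sup>2) * A (y\<^sup>2) \<le> (A (x * y))\<^sup>2)
     \<longleftrightarrow> (\<forall>x\<in>nonneg_square_set A. A (x\<^sup>2) * A 1 \<le> (A x)\<^sup>2))"
    (is "_ \<and> (?a \<longleftrightarrow> ?b)")
proof (intro conjI iffI)
  show one: "1 \<in> nonneg_square_set A" by (simp add: nonneg_square_set_def)
  show ?b if ?a
  proof
    fix x assume "x \<in> nonneg_square_set A"
    then have "A (x\<^sup>2) * A (1\<^sup>2) \<le> (A (x * 1))\<^sup>2" using \<open>?a\<close> one by blast
    then show "A (x\<^sup>2) * A 1 \<le> (A x)\<^sup>2" by simp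
  qed
  show ?a if ?b
  proof (intro ballI)
    have Q_nonneg: "A (z\<^sup>2) * A 1 \<le> (A z)\<^sup>2" for z
    proof (cases "z \<in> nonneg_square_set A")
      case True
      then show ?thesis using \<open>?b\<close> by blast
    next
      case False
      then have "A (z\<^sup>2) * A 1 < 0" by (simp add: nonneg_square_set_def)
      then show ?thesis using zero_le_power2[of "A z"] by linarith
    qed
    fix x y
    assume "x \<in> nonneg_square_set A" "y \<in> nonneg_square_set A"
    then have "0 \<le> A (x\<^sup>2) * A 1" "0 \<le> A (y\<^sup>2) * A 1"
      by (simp_all add: nonneg_square_set_def)
    then have "(A (x\<^sup>2) * A 1) * (A (y\<^sup>2) * A 1) \<le> (A (x * y) * A 1)\<^sup>2"
      by (intro reversed_cauchy_schwarz[of _ "A x" _ "A y"] Q_nonneg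
          additive_cauchy_schwarz[OF \<open>additive A\<close> Q_nonneg])
    then have "(A (x\<^sup>2) * A (y\<^sup>2)) * (A 1)\<^sup>2 \<le> (A (x * y))\<^sup>2 * (A 1)\<^sup>2"
      by (simp add: power2_eq_square mult_ac)
    then show "A (x\<^sup>2) * A (y\<^sup>2) \<le> (A (x * y))\<^sup>2"
      using \<open>A 1 \<noteq> 0\<close> by simp
  qed
qed

end
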